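(* Let $\mathcal{A}\in\mathbb{C}^{I(N)\times I(N)}$ with $\mathrm{ind}(\mathcal{A})=k$, and let $l$ be an integer with $l\ge k$. Then $\mathcal{A}^{\mathrm{cEP}}=\mathcal{A}^{\mathrm{D}}*_N\mathcal{A}^{l}*_N(\mathcal{A}^l)^{\dagger}$. Furthermore, $\mathcal{A}*_N\mathcal{A}^{\mathrm{cEP}}=\mathcal{A}^{l}*_N(\mathcal{A}^l)^{\dagger}$.
   Context: Let $I_1,\dots,I_N$ be positive integers. $\mathbb{C}^{I(N)\times I(N)}$ denotes the set of complex tensors of order $2N$ with entries $\mathcal{A}_{i_1\dots i_N j_1\dots j_N}$, where $1\le i_k,j_k\le I_k$. The Einstein product is $(\mathcal{A}*_N\mathcal{B})_{i_1\dots i_N j_1\dots j_N}=\sum_{k_1,\dots,k_N}\mathcal{A}_{i_1\dots i_N k_1\dots k_N}\mathcal{B}_{k_1\dots k_N j_1\dots j_N}$, and powers $\mathcal{A}^p$ are taken with respect to $*_N$. For $\mathcal{Z}\in\mathbb{C}^{I_1\times\cdots\times I_N}$, $(\mathcal{A}*_N\mathcal{Z})_{i_1\dots i_N}=\sum_{k_1,\dots,k_N}\mathcal{A}_{i_1\dots i_N k_1\dots k_N}\mathcal{Z}_{k_1\dots k_N}$, and the range is $\mathfrak{R}(\mathcal{A})=\{\mathcal{A}*_N\mathcal{Z}:\mathcal{Z}\in\mathbb{C}^{I_1\times\cdots\times I_N}\}$. The conjugate transpose $\mathcal{A}^*$ is defined by $(\mathcal{A}^* )_{j_1\dots j_N i_1\dots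 i_N}=\overline{\mathcal{A}_{i_1\dots i_N j_1\dots j_N}}$. The index $\mathrm{ind}(\mathcal{A})$ is the smallest positive integer $k$ such that $\mathfrak{R}(\mathcal{A}^k)=\mathfrak{R}(\mathcal{A}^{k+1})$. With $k=\mathrm{ind}(\mathcal{A})$: the Drazin inverse $\mathcal{A}^{\mathrm{D}}$ is the unique $\mathcal{X}$ with $\mathcal{A}^{k+1}*_N\mathcal{X}=\mathcal{A}^k$, $\mathcal{X}*_N\mathcal{A}*_N\mathcal{X}=\mathcal{X}$, $\mathcal{X}*_N\mathcal{A}=\mathcal{A}*_N\mathcal{X}$; the core-EP inverse $\mathcal{A}^{\mathrm{cEP}}$ is the unique $\mathcal{X}$ with $\mathcal{X}*_N\mathcal{A}^{k+1}=\mathcal{A}^k$, $\mathcal{A}*_N\mathcal{X}^2=\mathcal{X}$, $(\mathcal{A}*_N\mathcal{X})^*=\mathcal{A}*_N\mathcal{X}$. The Moore-Penrose inverse $\mathcal{B}^{\dagger}$ is the unique $\mathcal{X}$ with $\mathcal{B}*_N\mathcal{X}*_N\mathcal{B}=\mathcal{B}$, $\mathcal{X}*_N\mathcal{B}*_N\mathcal{X}=\mathcal{X}$, $(\mathcal{B}*_N\mathcal{X})^*=\mathcal{B}*_N\mathcal{X}$, $(\mathcal{X}*_N\mathcal{B})^*=\mathcal{X}*_N\mathcal{B}$. *)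

theory Defs
  imports Complex_Main
begin

text \<open>The list \<open>I\<close> holds the dimensions \<open>I\<^sub>1, \<dots>, I\<^sub>N\<close>, so \<open>N = length I\<close>; a multi-index
  is a list \<open>[i\<^sub>1, \<dots>, i\<^sub>N]\<close> with \<open>1 \<le> i\<^sub>k \<le> I\<^sub>k\<close>.\<close>

definition multi_indices :: "nat list \<Rightarrow> nat list set" where
  "multi_indices I = {is. list_all2 (\<lambda>i n. i \<in> {1..n}) is I}"

text \<open>A tensor of order \<open>2N\<close> is a function of two multi-indices that is zero outside the index
  range (likewise for order \<open>N\<close>). Hence equality of tensors is equality of functions.\<close>

type_synonym tensor2 = "nat list \<Rightarrow> nat list \<Rightarrow> complex"
type_synonym tensor1 = "nat list \<Rightarrow> complex"

definition tensors2 :: "nat list \<Rightarrow> tensor2 set" where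
  "tensors2 I = {A. \<forall>is js. is \<notin> multi_indices I \<or> js \<notin> multi_indices I \<longrightarrow> A is js = 0}"

definition tensors1 :: "nat list \<Rightarrow> tensor1 set" where
  "tensors1 I = {Z. \<forall>is. is \<notin> multi_indices I \<longrightarrow> Z is = 0}"

definition einstein :: "tensor2 \<Rightarrow> nat list \<Rightarrow> tensor2 \<Rightarrow> tensor2"
    ("(_ \<star>\<^bsub>_\<^esub> _)" [70, 0, 71] 70) where
  "A \<star>\<^bsub>I\<^esub> B = (\<lambda>is js. \<Sum>ks\<in>multi_indices I. A is ks * B ks js)"

definition einstein_apply :: "nat list \<Rightarrow> tensor2 \<Rightarrow> tensor1 \<Rightarrow> tensor1" where
  "einstein_apply I A Z = (\<lambda>is. \<Sum>ks\<in>multi_indices I. A is ks * Z ks)"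

definition identity_tensor :: "nat list \<Rightarrow> tensor2" where
  "identity_tensor I = (\<lambda>is js. if is \<in> multi_indices I \<and> is = js then 1 else 0)"

primrec tensor_power :: "nat list \<Rightarrow> tensor2 \<Rightarrow> nat \<Rightarrow> tensor2" where
  "tensor_power I A 0 = identity_tensor I"
| "tensor_power I A (Suc p) = tensor_power I A p \<star>\<^bsub>I\<^esub> A"

definition conj_transpose :: "tensor2 \<Rightarrow> tensor2" where
  "conj_transpose A = (\<lambda>js is. cnj (A is js))"

definition tensor_range :: "nat list \<Rightarrow> tensor2 \<Rightarrow> tensor1 set" where
  "tensor_range I A = {einstein_apply I A Z | Z. Z \<in> tensors1 I}"

definition tensor_ind :: "nat list \<Rightarrow> tensor2 \<Rightarrow> nat" where
  "tensor_ind I A = (LEAST k. 1 \<le> k \<and>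
     tensor_range I (tensor_power I A k) = tensor_range I (tensor_power I A (k + 1)))"

definition is_drazin_inverse :: "nat list \<Rightarrow> tensor2 \<Rightarrow> tensor2 \<Rightarrow> bool" where
  "is_drazin_inverse I A X \<longleftrightarrow> X \<in> tensors2 I \<and>
     tensor_power I A (tensor_ind I A + 1) \<star>\<^bsub>I\<^esub> X = tensor_power I A (tensor_ind I A) \<and>
     X \<star>\<^bsub>I\<^esub> A \<star>\<^bsub>I\<^esub> X = X \<and>
     X \<star>\<^bsub>I\<^esub> A = A \<star>\<^bsub>I\<^esub> X"

definition is_core_ep_inverse :: "nat list \<Rightarrow> tensor2 \<Rightarrow> tensor2 \<Rightarrow> bool" where
  "is_core_ep_inverse I A X \<longleftrightarrow> X \<in> tensors2 I \<and>
     X \<star>\<^bsub>I\<^esub> tensor_power I A (tensor_ind I A + 1) = tensor_power I A (tensor_ind I A) \<and>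
     A \<star>\<^bsub>I\<^esub> tensor_power I X 2 = X \<and>
     conj_transpose (A \<star>\<^bsub>I\<^esub> X) = A \<star>\<^bsub>I\<^esub> X"

definition is_mp_inverse :: "nat list \<Rightarrow> tensor2 \<Rightarrow> tensor2 \<Rightarrow> bool" where
  "is_mp_inverse I B X \<longleftrightarrow> X \<in> tensors2 I \<and>
     B \<star>\<^bsub>I\<^esub> X \<star>\<^bsub>I\<^esub> B = B \<and>
     X \<star>\<^bsub>I\<^esub> B \<star>\<^bsub>I\<^esub> X = X \<and>
     conj_transpose (B \<star>\<^bsub>I\<^esub> X) = B \<star>\<^bsub>I\<^esub> X \<and>
     conj_transpose (X \<star>\<^bsub>I\<^esub> B) = X \<star>\<^bsub>I\<^esub> B"

definition drazin_inverse :: "nat list \<Rightarrow> tensor2 \<Rightarrow> tensor2" where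
  "drazin_inverse I A = (THE X. is_drazin_inverse I A X)"

definition core_ep_inverse :: "nat list \<Rightarrow> tensor2 \<Rightarrow> tensor2" where
  "core_ep_inverse I A = (THE X. is_core_ep_inverse I A X)"

definition mp_inverse :: "nat list \<Rightarrow> tensor2 \<Rightarrow> tensor2" where
  "mp_inverse I B = (THE X. is_mp_inverse I B X)"

end

theory Submission
  imports Defs
begin

text \<open>Finite dimensionality gives a linear relation between the powers of a tensor \<open>A\<close>; dividing by
  its lowest coefficient yields \<open>A\<^sup>m = A\<^sup>m\<^sup>+\<^sup>1 R\<close> with \<open>R\<close> a polynomial in \<open>A\<close>. Together with the range
  condition this produces the Drazin inverse, and, applied to the Hermitian tensor \<open>B\<^sup>* B\<close> (where the
  positive definiteness of \<open>C\<^sup>* C\<close> allows cancelling down to \<open>m = 1\<close>), the Moore-Penrose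
  inverse of \<open>B\<close>. Since \<open>A\<^sup>k\<close> and \<open>A\<^sup>l\<close> have the same range, \<open>P = A\<^sup>l (A\<^sup>l)\<^sup>\<dagger>\<close> fixes \<open>A\<^sup>k\<close> and
  \<open>A\<^sup>D\<close>, so \<open>A\<^sup>D P\<close> satisfies the equations of the core-EP inverse, which determine it uniquely.\<close>

section \<open>The Einstein product\<close>

text \<open>A sum over an infinite set is 0 by convention, so this finiteness is what makes the
  products genuine sums.\<close>

lemma finite_multi_indices [simp]: "finite (multi_indices I)"
proof (induction I)
  case Nil
  then show ?case by (simp add: multi_indices_def)
next
  case (Cons n I)
  have "multi_indices (n # I) = (\<lambda>(i, is). i # is) ` ({1..n} \<times> multi_indices I)"
    by (auto simp: multi_indices_def list_all2_Cons2)
  with Cons show ?case by simp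
qed

lemma einstein_assoc: "A \<star>\<^bsub>I\<^esub> B \<star>\<^bsub>I\<^esub> C = A \<star>\<^bsub>I\<^esub> (B \<star>\<^bsub>I\<^esub> C)"
proof (intro ext)
  fix "is" js
  have "(A \<star>\<^bsub>I\<^esub> B \<star>\<^bsub>I\<^esub> C) is js
      = (\<Sum>ks\<in>multi_indices I. \<Sum>ls\<in>multi_indices I. A is ls * B ls ks * C ks js)"
    by (simp add: einstein_def sum_distrib_right)
  also have "\<dots> = (\<Sum>ls\<in>multi_indices I. \<Sum>ks\<in>multi_indices I. A is ls * B ls ks * C ks js)"
    by (rule sum.swap)
  also have "\<dots> = (A \<star>\<^bsub>I\<^esub> (B \<star>\<^bsub>I\<^esub> C)) is js"
    by (simp add: einstein_def sum_distrib_left mult.assoc)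
  finally show "(A \<star>\<^bsub>I\<^esub> B \<star>\<^bsub>I\<^esub> C) is js = (A \<star>\<^bsub>I\<^esub> (B \<star>\<^bsub>I\<^esub> C)) is js" .
qed

text \<open>Extensions of an equation between products by a right factor, in right-nested form
  for rewriting modulo associativity.\<close>

lemma einstein_extend2: "X \<star>\<^bsub>I\<^esub> Y = Z \<Longrightarrow> X \<star>\<^bsub>I\<^esub> (Y \<star>\<^bsub>I\<^esub> V) = Z \<star>\<^bsub>I\<^esub> V"
  by (simp flip: einstein_assoc)

lemma einstein_extend3:
  "X \<star>\<^bsub>I\<^esub> Y \<star>\<^bsub>I\<^esub> Z = W \<Longrightarrow> X \<star>\<^bsub>I\<^esub> (Y \<star>\<^bsub>I\<^esub> (Z \<star>\<^bsub>I\<^esub> V)) = W \<star>\<^bsub>I\<^esub> V"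
  by (simp flip: einstein_assoc)

lemma einstein_apply_einstein:
  "einstein_apply I (A \<star>\<^bsub>I\<^esub> B) Z = einstein_apply I A (einstein_apply I B Z)"
proof
  fix "is"
  have "einstein_apply I (A \<star>\<^bsub>I\<^esub> B) Z is
      = (\<Sum>ks\<in>multi_indices I. \<Sum>ls\<in>multi_indices I. A is ls * B ls ks * Z ks)"
    by (simp add: einstein_def einstein_apply_def sum_distrib_right)
  also have "\<dots> = (\<Sum>ls\<in>multi_indices I. \<Sum>ks\<in>multi_indices I. A is ls * B ls ks * Z ks)"
    by (rule sum.swap)
  also have "\<dots> = einstein_apply I A (einstein_apply I B Z) is"
    by (simp add: einstein_apply_def sum_distrib_left mult.assoc)
  finally show "einstein_apply I (A \<star>\<^bsub>I\<^esub> B) Z is = einstein_apply I A (einstein_apply I B Z) is" .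
qed

lemma einstein_closed [simp]:
  "A \<in> tensors2 I \<Longrightarrow> B \<in> tensors2 I \<Longrightarrow> A \<star>\<^bsub>I\<^esub> B \<in> tensors2 I"
  by (auto simp: tensors2_def einstein_def)

lemma einstein_apply_closed: "A \<in> tensors2 I \<Longrightarrow> einstein_apply I A Z \<in> tensors1 I"
  by (auto simp: tensors2_def tensors1_def einstein_apply_def)

lemma identity_tensor_closed [simp]: "identity_tensor I \<in> tensors2 I"
  by (auto simp: tensors2_def identity_tensor_def)

text \<open>At row indices out of range the product with the identity is zero, so \<open>A\<close>
  has to vanish there as well.\<close>

lemma einstein_identity_left [simp]:
  assumes "A \<in> tensors2 I"
  shows "identity_tensor I \<star>\<^bsub>I\<^esub> A = A"
proof (intro ext)
  fix "is" js
  have "(identity_tensor I \<star>\<^bsub>I\<^esub> A) is js = (\<Sum>ks\<in>multi_indices I. if is = ks then A ks js else 0)"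
    unfolding einstein_def by (rule sum.cong) (auto simp: identity_tensor_def)
  with assms show "(identity_tensor I \<star>\<^bsub>I\<^esub> A) is js = A is js"
    by (auto simp: tensors2_def)
qed

lemma einstein_identity_right [simp]:
  assumes "A \<in> tensors2 I"
  shows "A \<star>\<^bsub>I\<^esub> identity_tensor I = A"
proof (intro ext)
  fix "is" js
  have "(A \<star>\<^bsub>I\<^esub> identity_tensor I) is js = (\<Sum>ks\<in>multi_indices I. if ks = js then A is ks else 0)"
    unfolding einstein_def by (rule sum.cong) (auto simp: identity_tensor_def)
  with assms show "(A \<star>\<^bsub>I\<^esub> identity_tensor I) is js = A is js"
    by (auto simp: tensors2_def)
qed

section \<open>Powers and linear combinations of tensors\<close>

lemma tensor_power_closed [simp]: "A \<in> tensors2 I \<Longrightarrow> tensor_power I A n \<in> tensors2 I"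
  by (induction n) auto

lemma tensor_power_add:
  "A \<in> tensors2 I \<Longrightarrow>
    tensor_power I A (m + n) = tensor_power I A m \<star>\<^bsub>I\<^esub> tensor_power I A n"
  by (induction n) (auto simp: einstein_assoc)

lemma tensor_power_commute:
  assumes "A \<in> tensors2 I" "R \<in> tensors2 I" "R \<star>\<^bsub>I\<^esub> A = A \<star>\<^bsub>I\<^esub> R"
  shows "R \<star>\<^bsub>I\<^esub> tensor_power I A n = tensor_power I A n \<star>\<^bsub>I\<^esub> R"
proof (induction n)
  case 0
  show ?case using assms by simp
next
  case (Suc n)
  have "R \<star>\<^bsub>I\<^esub> tensor_power I A (Suc n) = (R \<star>\<^bsub>I\<^esub> tensor_power I A n) \<star>\<^bsub>I\<^esub> A"
    by (simp add: einstein_assoc)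
  also have "\<dots> = tensor_power I A n \<star>\<^bsub>I\<^esub> (R \<star>\<^bsub>I\<^esub> A)"
    by (simp add: Suc einstein_assoc)
  finally show ?case by (simp add: assms(3) einstein_assoc)
qed

text \<open>The recursion appends the new factor on the right; since \<open>A\<close> commutes with
  itself, it may be moved to the left.\<close>

lemma tensor_power_Suc_left:
  "A \<in> tensors2 I \<Longrightarrow> tensor_power I A (Suc n) = A \<star>\<^bsub>I\<^esub> tensor_power I A n"
  by (simp add: tensor_power_commute)

text \<open>Linear combinations are written entrywise. This law and its mirror image let a
  polynomial in \<open>A\<close> be multiplied by \<open>A\<close> from either side.\<close>

lemma einstein_sum_right:
  "A \<star>\<^bsub>I\<^esub> (\<lambda>is js. \<Sum>t\<in>T. c t * B t is js) = (\<lambda>is js. \<Sum>t\<in>T. c t * (A \<star>\<^bsub>I\<^esub> B t) is js)"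
proof (intro ext)
  fix "is" js
  have "(A \<star>\<^bsub>I\<^esub> (\<lambda>is js. \<Sum>t\<in>T. c t * B t is js)) is js
      = (\<Sum>ks\<in>multi_indices I. \<Sum>t\<in>T. c t * (A is ks * B t ks js))"
    by (simp add: einstein_def sum_distrib_left mult_ac)
  also have "\<dots> = (\<Sum>t\<in>T. \<Sum>ks\<in>multi_indices I. c t * (A is ks * B t ks js))"
    by (rule sum.swap)
  finally show "(A \<star>\<^bsub>I\<^esub> (\<lambda>is js. \<Sum>t\<in>T. c t * B t is js)) is js
      = (\<Sum>t\<in>T. c t * (A \<star>\<^bsub>I\<^esub> B t) is js)"
    by (simp add: einstein_def sum_distrib_left)
qed

lemma einstein_sum_left:
  "(\<lambda>is js. \<Sum>t\<in>T. c t * B t is js) \<star>\<^bsub>I\<^esub> A = (\<lambda>is js. \<Sum>t\<in>T. c t * (B t \<star>\<^bsub>I\<^esub> A) is js)"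
proof (intro ext)
  fix "is" js
  have "((\<lambda>is js. \<Sum>t\<in>T. c t * B t is js) \<star>\<^bsub>I\<^esub> A) is js
      = (\<Sum>ks\<in>multi_indices I. \<Sum>t\<in>T. c t * (B t is ks * A ks js))"
    by (simp add: einstein_def sum_distrib_right mult.assoc)
  also have "\<dots> = (\<Sum>t\<in>T. \<Sum>ks\<in>multi_indices I. c t * (B t is ks * A ks js))"
    by (rule sum.swap)
  finally show "((\<lambda>is js. \<Sum>t\<in>T. c t * B t is js) \<star>\<^bsub>I\<^esub> A) is js
      = (\<Sum>t\<in>T. c t * (B t \<star>\<^bsub>I\<^esub> A) is js)"
    by (simp add: einstein_def sum_distrib_left)
qed

lemma einstein_diff_right: "A \<star>\<^bsub>I\<^esub> (B - C) = A \<star>\<^bsub>I\<^esub> B - A \<star>\<^bsub>I\<^esub> C"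
  by (simp add: einstein_def fun_eq_iff right_diff_distrib sum_subtractf)

section \<open>Conjugate transpose and cancellation\<close>

lemma conj_transpose_einstein:
  "conj_transpose (A \<star>\<^bsub>I\<^esub> B) = conj_transpose B \<star>\<^bsub>I\<^esub> conj_transpose A"
  by (simp add: conj_transpose_def einstein_def fun_eq_iff mult.commute)

lemma conj_transpose_conj_transpose [simp]: "conj_transpose (conj_transpose A) = A"
  by (simp add: conj_transpose_def)

lemma conj_transpose_closed [simp]: "A \<in> tensors2 I \<Longrightarrow> conj_transpose A \<in> tensors2 I"
  by (auto simp: tensors2_def conj_transpose_def)

text \<open>The diagonal entry at \<open>js\<close> is the sum of the squared moduli of the entries
  in column \<open>js\<close> of \<open>C\<close>, and a vanishing sum of nonnegative terms has only
  zero terms.\<close>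

lemma conj_transpose_einstein_self_eq_0D:
  assumes "conj_transpose C \<star>\<^bsub>I\<^esub> C = (\<lambda>is js. 0)" "ks \<in> multi_indices I"
  shows "C ks js = 0"
proof -
  have "(conj_transpose C \<star>\<^bsub>I\<^esub> C) js js = 0"
    using assms by simp
  then have "of_real (\<Sum>ks\<in>multi_indices I. (cmod (C ks js))\<^sup>2) = (0 :: complex)"
    by (simp add: einstein_def conj_transpose_def complex_norm_square mult.commute del: of_real_power)
  then have "(\<Sum>ks\<in>multi_indices I. (cmod (C ks js))\<^sup>2) = 0"
    by (simp only: of_real_eq_0_iff)
  then show ?thesis
    using assms(2) by (simp add: sum_nonneg_eq_0_iff)
qed

text \<open>For C = B (Y - Z) the hypothesis says that the conjugate transpose of \<open>B\<close>
  annihilates \<open>C\<close>. Hence so does that of \<open>C\<close>, and positive definiteness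
  gives C = 0.\<close>

lemma conj_transpose_cancel_left:
  assumes B: "B \<in> tensors2 I"
    and eq: "conj_transpose B \<star>\<^bsub>I\<^esub> (B \<star>\<^bsub>I\<^esub> Y) = conj_transpose B \<star>\<^bsub>I\<^esub> (B \<star>\<^bsub>I\<^esub> Z)"
  shows "B \<star>\<^bsub>I\<^esub> Y = B \<star>\<^bsub>I\<^esub> Z"
proof -
  define C where "C = B \<star>\<^bsub>I\<^esub> (Y - Z)"
  have "conj_transpose B \<star>\<^bsub>I\<^esub> C = (\<lambda>is js. 0)"
    by (simp add: C_def einstein_diff_right eq fun_eq_iff)
  then have "conj_transpose C \<star>\<^bsub>I\<^esub> C = (\<lambda>is js. 0)"
    unfolding C_def conj_transpose_einstein einstein_assoc
    by (simp add: einstein_def)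
  then have "C is js = 0" for "is" js
    using conj_transpose_einstein_self_eq_0D[of C I "is" js] B
    by (cases "is \<in> multi_indices I") (auto simp: C_def einstein_def tensors2_def)
  then show ?thesis
    by (simp add: C_def einstein_diff_right fun_eq_iff)
qed

section \<open>A polynomial relation\<close>

text \<open>Gaussian elimination, one equation at a time.\<close>

lemma underdetermined_system_nontrivial_solution:
  fixes f :: "'t \<Rightarrow> 's \<Rightarrow> 'f::field"
  assumes "finite S" "finite T" "card S < card T"
  shows "\<exists>c. (\<exists>t\<in>T. c t \<noteq> 0) \<and> (\<forall>s\<in>S. (\<Sum>t\<in>T. c t * f t s) = 0)"
  using assms
proof (induction S arbitrary: T f rule: finite_induct)
  case empty
  then have "T \<noteq> {}" by auto
  \<comment> \<open>With no equation left, any nonzero assignment solves the system.\<close>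
  then show ?case by (intro exI[of _ "\<lambda>_. 1"]) auto
next
  case (insert s S)
  show ?case
  proof (cases "\<forall>t\<in>T. f t s = 0")
    case True
    with insert.IH[of T f] insert.prems insert.hyps show ?thesis by auto
  next
    case False
    then obtain u where u: "u \<in> T" "f u s \<noteq> 0" by auto
    define T' where "T' = T - {u}"
    \<comment> \<open>The pivot \<open>f u s\<close> is used to eliminate the unknown
      \<open>u\<close> from every equation.\<close>
    define g where "g t r = f t r - f t s / f u s * f u r" for t r
    have T': "finite T'" "u \<notin> T'" "T = insert u T'"
      using u insert.prems by (auto simp: T'_def)
    have "card S < card T'"
      using insert.prems insert.hyps T' by simp
    with insert.IH[of T' g] T' obtain c where
      c: "\<exists>t\<in>T'. c t \<noteq> 0" and sol: "\<And>r. r \<in> S \<Longrightarrow> (\<Sum>t\<in>T'. c t * g t r) = 0"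
      by auto
    \<comment> \<open>The value at \<open>u\<close> is the one that equation \<open>s\<close> forces
      once the other unknowns are given by \<open>c\<close>.\<close>
    define d where "d = c(u := - (\<Sum>t\<in>T'. c t * (f t s / f u s)))"
    have split: "(\<Sum>t\<in>T. d t * f t r) = (\<Sum>t\<in>T'. c t * g t r)" for r
    proof -
      have "(\<Sum>t\<in>T'. d t * f t r) = (\<Sum>t\<in>T'. c t * f t r)"
        using T' by (intro sum.cong) (auto simp: d_def)
      then show ?thesis
        using T' by (simp add: d_def g_def right_diff_distrib sum_subtractf sum_distrib_right mult.assoc)
    qed
    \<comment> \<open>Elimination turns equation \<open>s\<close> itself into 0 = 0, since
      \<open>g t s\<close> is zero for every \<open>t\<close>.\<close>
    have "(\<Sum>t\<in>T. d t * f t s) = 0"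
      unfolding split using u by (simp add: g_def)
    moreover have "\<exists>t\<in>T. d t \<noteq> 0"
      using c T' by (auto simp: d_def)
    ultimately show ?thesis
      using sol split by (intro exI[of _ d]) auto
  qed
qed

text \<open>A tensor has \<open>card ?S\<close> entries in range, while the powers with exponents 0
  up to \<open>card ?S\<close> are one more in number. Requiring each entry of the combination to
  vanish is thus an underdetermined system.\<close>

lemma tensor_power_linear_relation:
  assumes "A \<in> tensors2 I"
  obtains c :: "nat \<Rightarrow> complex" and n where "\<exists>t\<le>n. c t \<noteq> 0"
    "(\<lambda>is js. \<Sum>t\<le>n. c t * tensor_power I A t is js) = (\<lambda>is js. 0)"
proof -
  let ?S = "multi_indices I \<times> multi_indices I"
  obtain c :: "nat \<Rightarrow> complex" where c: "\<exists>t\<in>{..card ?S}. c t \<noteq> 0"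
    "\<And>is js. is \<in> multi_indices I \<Longrightarrow> js \<in> multi_indices I \<Longrightarrow>
      (\<Sum>t\<le>card ?S. c t * tensor_power I A t is js) = 0"
    using underdetermined_system_nontrivial_solution
      [of ?S "{..card ?S}" "\<lambda>t (is, js). tensor_power I A t is js"]
    by auto
  have "tensor_power I A t \<in> tensors2 I" for t
    using assms by simp
  then have "(\<Sum>t\<le>card ?S. c t * tensor_power I A t is js) = 0" for "is" js
    using c(2)[of "is" js]
    by (cases "is \<in> multi_indices I \<and> js \<in> multi_indices I") (auto simp: tensors2_def)
  with c(1) show ?thesis
    by (intro that[of "card ?S" c]) auto
qed

text \<open>Solve the relation for its lowest surviving power A^m. All other terms have exponent at
  least m + 1, so A^(m+1) can be factored out, and the cofactor \<open>R\<close> commutes with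
  \<open>A\<close> because it is a polynomial in \<open>A\<close>.\<close>

lemma tensor_power_eq_Suc_commuting:
  assumes A: "A \<in> tensors2 I"
  obtains m R where "R \<in> tensors2 I" "R \<star>\<^bsub>I\<^esub> A = A \<star>\<^bsub>I\<^esub> R"
    "tensor_power I A m = tensor_power I A (Suc m) \<star>\<^bsub>I\<^esub> R"
proof -
  obtain c :: "nat \<Rightarrow> complex" and n where c: "\<exists>t\<le>n. c t \<noteq> 0"
    and rel: "(\<lambda>is js. \<Sum>t\<le>n. c t * tensor_power I A t is js) = (\<lambda>is js. 0)"
    by (rule tensor_power_linear_relation[OF A])
  define m where "m = (LEAST t. c t \<noteq> 0)"
  have m: "c m \<noteq> 0" "m \<le> n" and below: "\<And>t. t < m \<Longrightarrow> c t = 0"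
  proof -
    from c obtain t where t: "t \<le> n" "c t \<noteq> 0" by blast
    show "c m \<noteq> 0"
      unfolding m_def using t(2) by (rule LeastI)
    show "m \<le> n"
      unfolding m_def using t by (blast intro: Least_le order_trans)
    show "c t = 0" if "t < m" for t
      using not_less_Least that unfolding m_def by blast
  qed
  define T where "T = {m<..n}"
  \<comment> \<open>The subtraction in the exponent never truncates, because t > m on
    \<open>T\<close>.\<close>
  define R where "R = (\<lambda>is js. \<Sum>t\<in>T. - (c t / c m) * tensor_power I A (t - Suc m) is js)"
  have "tensor_power I A t \<in> tensors2 I" for t
    using A by simp
  then have 1: "R \<in> tensors2 I"
    by (auto simp: R_def tensors2_def)
  have 2: "R \<star>\<^bsub>I\<^esub> A = A \<star>\<^bsub>I\<^esub> R"
    unfolding R_def einstein_sum_left einstein_sum_right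
    using A by (simp add: tensor_power_commute)
  have "tensor_power I A (Suc m) \<star>\<^bsub>I\<^esub> R = (\<lambda>is js. \<Sum>t\<in>T. - (c t / c m) * tensor_power I A t is js)"
    unfolding R_def einstein_sum_right
  proof (intro ext sum.cong refl)
    fix "is" js t
    assume "t \<in> T"
    then have "Suc m + (t - Suc m) = t"
      by (auto simp: T_def)
    then show "- (c t / c m) * (tensor_power I A (Suc m) \<star>\<^bsub>I\<^esub> tensor_power I A (t - Suc m)) is js
        = - (c t / c m) * tensor_power I A t is js"
      by (simp only: tensor_power_add[OF A, symmetric])
  qed
  also have "\<dots> = tensor_power I A m"
  proof (intro ext)
    fix "is" js
    have "{..n} = {..<m} \<union> insert m T" "{..<m} \<inter> insert m T = {}"
      using m by (auto simp: T_def)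
    then have "(\<Sum>t\<le>n. c t * tensor_power I A t is js)
        = c m * tensor_power I A m is js + (\<Sum>t\<in>T. c t * tensor_power I A t is js)"
      by (simp add: sum.union_disjoint below T_def)
    with fun_cong[OF fun_cong[OF rel, of "is"], of js]
    have "(\<Sum>t\<in>T. c t * tensor_power I A t is js) = - (c m * tensor_power I A m is js)"
      by (simp add: add_eq_0_iff)
    moreover have "(\<Sum>t\<in>T. - (c t / c m) * tensor_power I A t is js)
        = - (\<Sum>t\<in>T. c t * tensor_power I A t is js) / c m"
      by (simp add: sum_divide_distrib sum_negf)
    ultimately show "(\<Sum>t\<in>T. - (c t / c m) * tensor_power I A t is js) = tensor_power I A m is js"
      using m by simp
  qed
  finally show ?thesis
    by (rule that[OF 1 2 sym])
qed

section \<open>Moore-Penrose inverse\<close>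

text \<open>BX and BY are Hermitian idempotents that fix \<open>B\<close> from the left, so they
  agree; XB and YB agree likewise. Then X = XBX = XBY = YBY = Y.\<close>

lemma is_mp_inverse_unique:
  assumes "is_mp_inverse I B X" "is_mp_inverse I B Y"
  shows "X = Y"
proof -
  have X: "B \<star>\<^bsub>I\<^esub> X \<star>\<^bsub>I\<^esub> B = B" "X \<star>\<^bsub>I\<^esub> B \<star>\<^bsub>I\<^esub> X = X"
    "conj_transpose (B \<star>\<^bsub>I\<^esub> X) = B \<star>\<^bsub>I\<^esub> X" "conj_transpose (X \<star>\<^bsub>I\<^esub> B) = X \<star>\<^bsub>I\<^esub> B"
    and Y: "B \<star>\<^bsub>I\<^esub> Y \<star>\<^bsub>I\<^esub> B = B" "Y \<star>\<^bsub>I\<^esub> B \<star>\<^bsub>I\<^esub> Y = Y"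
    "conj_transpose (B \<star>\<^bsub>I\<^esub> Y) = B \<star>\<^bsub>I\<^esub> Y" "conj_transpose (Y \<star>\<^bsub>I\<^esub> B) = Y \<star>\<^bsub>I\<^esub> B"
    using assms by (auto simp: is_mp_inverse_def)
  have "B \<star>\<^bsub>I\<^esub> X = (B \<star>\<^bsub>I\<^esub> Y) \<star>\<^bsub>I\<^esub> (B \<star>\<^bsub>I\<^esub> X)"
    using einstein_extend3[OF Y(1)] by (simp add: einstein_assoc)
  also have "\<dots> = conj_transpose ((B \<star>\<^bsub>I\<^esub> X) \<star>\<^bsub>I\<^esub> (B \<star>\<^bsub>I\<^esub> Y))"
    by (simp add: conj_transpose_einstein[of "B \<star>\<^bsub>I\<^esub> X"] X Y)
  also have "\<dots> = B \<star>\<^bsub>I\<^esub> Y"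
    using einstein_extend3[OF X(1)] Y(3) by (simp add: einstein_assoc)
  finally have BX: "B \<star>\<^bsub>I\<^esub> X = B \<star>\<^bsub>I\<^esub> Y" .
  have "X \<star>\<^bsub>I\<^esub> B = (X \<star>\<^bsub>I\<^esub> B) \<star>\<^bsub>I\<^esub> (Y \<star>\<^bsub>I\<^esub> B)"
    using Y(1) by (simp add: einstein_assoc)
  also have "\<dots> = conj_transpose ((Y \<star>\<^bsub>I\<^esub> B) \<star>\<^bsub>I\<^esub> (X \<star>\<^bsub>I\<^esub> B))"
    by (simp add: conj_transpose_einstein[of "Y \<star>\<^bsub>I\<^esub> B"] X Y)
  also have "\<dots> = Y \<star>\<^bsub>I\<^esub> B"
    using X(1) Y(4) by (simp add: einstein_assoc)
  finally have XB: "X \<star>\<^bsub>I\<^esub> B = Y \<star>\<^bsub>I\<^esub> B" .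
  have "X = X \<star>\<^bsub>I\<^esub> (B \<star>\<^bsub>I\<^esub> X)"
    using X(2) by (simp add: einstein_assoc)
  also have "\<dots> = (X \<star>\<^bsub>I\<^esub> B) \<star>\<^bsub>I\<^esub> Y"
    unfolding BX by (simp add: einstein_assoc)
  also have "\<dots> = Y"
    unfolding XB by (rule Y(2))
  finally show ?thesis .
qed

text \<open>In H^m = H^(m+1) R the surplus factors \<open>H\<close> cancel on the left, because
  \<open>H\<close> is its own conjugate transpose. This leaves H = HHR, where \<open>R\<close> need
  not be Hermitian and is symmetrised at the end.\<close>

lemma hermitian_commuting_inner_inverse:
  assumes H: "H \<in> tensors2 I" "conj_transpose H = H"
  obtains S where "S \<in> tensors2 I" "conj_transpose S = S" "S \<star>\<^bsub>I\<^esub> H = H \<star>\<^bsub>I\<^esub> S"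
    "H \<star>\<^bsub>I\<^esub> H \<star>\<^bsub>I\<^esub> S = H"
proof -
  obtain m R where R: "R \<in> tensors2 I" "R \<star>\<^bsub>I\<^esub> H = H \<star>\<^bsub>I\<^esub> R"
    "tensor_power I H m = tensor_power I H (Suc m) \<star>\<^bsub>I\<^esub> R"
    using tensor_power_eq_Suc_commuting[OF H(1)] by blast
  have "H \<star>\<^bsub>I\<^esub> tensor_power I H m = H \<star>\<^bsub>I\<^esub> (tensor_power I H (Suc m) \<star>\<^bsub>I\<^esub> R)"
    using R(3) by simp
  \<comment> \<open>The extra factor \<open>H\<close> on both sides keeps the claim in the form that
    cancellation reproduces, with \<open>m\<close> lowered by one each time.\<close>
  then have HHR: "H = H \<star>\<^bsub>I\<^esub> (H \<star>\<^bsub>I\<^esub> R)"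
  proof (induction m)
    case 0
    with H R show ?case by simp
  next
    case (Suc m)
    have "conj_transpose H \<star>\<^bsub>I\<^esub> (H \<star>\<^bsub>I\<^esub> tensor_power I H m)
        = conj_transpose H \<star>\<^bsub>I\<^esub> (H \<star>\<^bsub>I\<^esub> (tensor_power I H (Suc m) \<star>\<^bsub>I\<^esub> R))"
      using Suc.prems
      by (simp add: tensor_power_Suc_left[OF H(1)] einstein_assoc H(2) del: tensor_power.simps)
    then show ?case
      using Suc.IH conj_transpose_cancel_left[OF H(1)] by blast
  qed
  define R' where "R' = conj_transpose R"
  have R': "R' \<in> tensors2 I" "R' \<star>\<^bsub>I\<^esub> H = H \<star>\<^bsub>I\<^esub> R'"
    using R(1) arg_cong[OF R(2), of conj_transpose]
    unfolding R'_def conj_transpose_einstein H(2) by simp_all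
  have HHR': "H = H \<star>\<^bsub>I\<^esub> (H \<star>\<^bsub>I\<^esub> R')"
    using arg_cong[OF HHR, of conj_transpose] R'(2)
    by (simp add: conj_transpose_einstein H(2) einstein_assoc einstein_extend2[OF R'(2)] flip: R'_def)
  \<comment> \<open>This symmetrised product is Hermitian; HHS = H follows by absorbing first
    \<open>R\<close> and then \<open>R'\<close>.\<close>
  define S where "S = R \<star>\<^bsub>I\<^esub> (H \<star>\<^bsub>I\<^esub> R')"
  show ?thesis
  proof (rule that)
    show "S \<in> tensors2 I"
      using R R' H by (simp add: S_def)
    show "conj_transpose S = S"
      by (simp add: S_def R'_def conj_transpose_einstein H(2) einstein_assoc)
    show "S \<star>\<^bsub>I\<^esub> H = H \<star>\<^bsub>I\<^esub> S"
      by (simp add: S_def einstein_assoc R'(2) einstein_extend2[OF R(2)])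
    show "H \<star>\<^bsub>I\<^esub> H \<star>\<^bsub>I\<^esub> S = H"
      using HHR' einstein_extend3[of H I H R H "H \<star>\<^bsub>I\<^esub> R'"] HHR
      by (simp add: S_def einstein_assoc)
  qed
qed

text \<open>The normal equations suggest the candidate S B', where S is the inner inverse of H = B'
  B.\<close>

lemma is_mp_inverse_exists:
  assumes B: "B \<in> tensors2 I"
  shows "\<exists>X. is_mp_inverse I B X"
proof -
  define B' where "B' = conj_transpose B"
  define H where "H = B' \<star>\<^bsub>I\<^esub> B"
  have B': "B' \<in> tensors2 I" "conj_transpose B = B'" "conj_transpose B' = B"
    using B by (simp_all add: B'_def)
  have H: "H \<in> tensors2 I" "conj_transpose H = H"
    using B B' by (simp_all add: H_def conj_transpose_einstein)
  obtain S where S: "S \<in> tensors2 I" "conj_transpose S = S" "S \<star>\<^bsub>I\<^esub> H = H \<star>\<^bsub>I\<^esub> S"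
    and HHS: "H \<star>\<^bsub>I\<^esub> H \<star>\<^bsub>I\<^esub> S = H"
    using hermitian_commuting_inner_inverse[OF H] by blast
  \<comment> \<open>This is HHS = H in the shape needed to cancel B', giving B (H S) = B.\<close>
  have "conj_transpose B \<star>\<^bsub>I\<^esub> (B \<star>\<^bsub>I\<^esub> (H \<star>\<^bsub>I\<^esub> S)) = conj_transpose B \<star>\<^bsub>I\<^esub> (B \<star>\<^bsub>I\<^esub> identity_tensor I)"
    using HHS B by (simp add: B' H_def einstein_assoc)
  then have BHS: "B \<star>\<^bsub>I\<^esub> (H \<star>\<^bsub>I\<^esub> S) = B"
    using conj_transpose_cancel_left[OF B, of "H \<star>\<^bsub>I\<^esub> S" "identity_tensor I"] B by simp
  define X where "X = S \<star>\<^bsub>I\<^esub> B'"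
  have XB: "X \<star>\<^bsub>I\<^esub> B = H \<star>\<^bsub>I\<^esub> S"
    using S(3) by (simp add: X_def H_def einstein_assoc)
  have BXB: "B \<star>\<^bsub>I\<^esub> X \<star>\<^bsub>I\<^esub> B = B"
    using BHS XB by (simp add: einstein_assoc)
  have "conj_transpose (B \<star>\<^bsub>I\<^esub> X) = B \<star>\<^bsub>I\<^esub> X"
    by (simp add: X_def conj_transpose_einstein B' S(2) einstein_assoc)
  moreover have "conj_transpose (X \<star>\<^bsub>I\<^esub> B) = X \<star>\<^bsub>I\<^esub> B"
    unfolding XB by (simp add: conj_transpose_einstein H(2) S)
  \<comment> \<open>Passing from \<open>X\<close> to XBX keeps both projections BX and XB, and the
    outer equation then follows from BXB = B.\<close>
  moreover have "B \<star>\<^bsub>I\<^esub> (X \<star>\<^bsub>I\<^esub> B \<star>\<^bsub>I\<^esub> X) = B \<star>\<^bsub>I\<^esub> X" "(X \<star>\<^bsub>I\<^esub> B \<star>\<^bsub>I\<^esub> X) \<star>\<^bsub>I\<^esub> B = X \<star>\<^bsub>I\<^esub> B"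
    using BXB einstein_extend3[OF BXB] by (simp_all add: einstein_assoc)
  moreover have "(X \<star>\<^bsub>I\<^esub> B \<star>\<^bsub>I\<^esub> X) \<star>\<^bsub>I\<^esub> B \<star>\<^bsub>I\<^esub> (X \<star>\<^bsub>I\<^esub> B \<star>\<^bsub>I\<^esub> X) = X \<star>\<^bsub>I\<^esub> B \<star>\<^bsub>I\<^esub> X"
    using einstein_extend3[OF BXB] by (simp add: einstein_assoc)
  ultimately have "is_mp_inverse I B (X \<star>\<^bsub>I\<^esub> B \<star>\<^bsub>I\<^esub> X)"
    using B S(1) B'(1) BXB by (simp add: is_mp_inverse_def X_def)
  then show ?thesis by (intro exI)
qed

lemma is_mp_inverse_mp_inverse: "B \<in> tensors2 I \<Longrightarrow> is_mp_inverse I B (mp_inverse I B)"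
  unfolding mp_inverse_def using is_mp_inverse_exists is_mp_inverse_unique by (metis theI)

section \<open>Index and Drazin inverse\<close>

text \<open>Column \<open>js\<close> of \<open>B\<close> is the image of a unit vector, hence of the
  form C Z for some Z. The chosen vectors are the columns of \<open>Y\<close>.\<close>

lemma tensor_range_subset_factor:
  assumes B: "B \<in> tensors2 I" and sub: "tensor_range I B \<subseteq> tensor_range I C"
  obtains Y where "Y \<in> tensors2 I" "B = C \<star>\<^bsub>I\<^esub> Y"
proof -
  have "\<exists>Z\<in>tensors1 I. (\<lambda>is. B is js) = einstein_apply I C Z" if "js \<in> multi_indices I" for js
  proof -
    have "(\<lambda>is. identity_tensor I is js) \<in> tensors1 I"
      by (auto simp: tensors1_def identity_tensor_def)
    moreover have "einstein_apply I B (\<lambda>is. identity_tensor I is js) = (\<lambda>is. B is js)"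
      using einstein_identity_right[OF B] by (simp add: einstein_def einstein_apply_def fun_eq_iff)
    ultimately have "(\<lambda>is. B is js) \<in> tensor_range I B"
      unfolding tensor_range_def by (metis (mono_tags, lifting) mem_Collect_eq)
    with sub show ?thesis
      by (auto simp: tensor_range_def)
  qed
  then obtain Z where Z: "\<And>js. js \<in> multi_indices I \<Longrightarrow> Z js \<in> tensors1 I"
    "\<And>js. js \<in> multi_indices I \<Longrightarrow> (\<lambda>is. B is js) = einstein_apply I C (Z js)"
    by metis
  \<comment> \<open>Columns out of range are set to zero so that \<open>Y\<close> is a tensor in
    \<open>tensors2 I\<close>.\<close>
  define Y where "Y = (\<lambda>is js. if js \<in> multi_indices I then Z js is else 0)"
  have "Y \<in> tensors2 I"
    using Z(1) by (auto simp: Y_def tensors2_def tensors1_def)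
  moreover have "B is js = (C \<star>\<^bsub>I\<^esub> Y) is js" for "is" js
    using fun_cong[OF Z(2), of js "is"] B
    by (cases "js \<in> multi_indices I") (auto simp: Y_def einstein_def einstein_apply_def tensors2_def)
  ultimately show ?thesis
    using that by blast
qed

lemma tensor_range_einstein_subset:
  "Y \<in> tensors2 I \<Longrightarrow> tensor_range I (C \<star>\<^bsub>I\<^esub> Y) \<subseteq> tensor_range I C"
  by (auto simp: tensor_range_def einstein_apply_einstein intro: einstein_apply_closed)

text \<open>The \<open>LEAST\<close> has its defining property only if some exponent has it; the
  polynomial relation supplies one.\<close>

lemma tensor_ind_range:
  assumes A: "A \<in> tensors2 I"
  shows "tensor_range I (tensor_power I A (tensor_ind I A))
    = tensor_range I (tensor_power I A (tensor_ind I A + 1))"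
proof -
  obtain m R where R: "R \<in> tensors2 I" "R \<star>\<^bsub>I\<^esub> A = A \<star>\<^bsub>I\<^esub> R"
    "tensor_power I A m = tensor_power I A (Suc m) \<star>\<^bsub>I\<^esub> R"
    using tensor_power_eq_Suc_commuting[OF A] by blast
  \<comment> \<open>Multiplying once more by \<open>A\<close> shifts the exponent to
    \<open>Suc m\<close>, which is at least 1 as the index demands.\<close>
  then have "tensor_power I A (Suc m) = tensor_power I A (Suc m + 1) \<star>\<^bsub>I\<^esub> R"
    using tensor_power_Suc_left[OF A, of m] tensor_power_Suc_left[OF A, of "Suc m"]
    by (simp only: Suc_eq_plus1[symmetric] einstein_assoc)
  then have "tensor_range I (tensor_power I A (Suc m)) = tensor_range I (tensor_power I A (Suc m + 1))"
    using tensor_range_einstein_subset[OF R(1), of "tensor_power I A (Suc m + 1)"]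
      tensor_range_einstein_subset[OF A, of "tensor_power I A (Suc m)"]
    by (simp del: tensor_power.simps(2) add: tensor_power.simps(2)[of _ _ "Suc m"])
  then have "1 \<le> Suc m \<and>
      tensor_range I (tensor_power I A (Suc m)) = tensor_range I (tensor_power I A (Suc m + 1))"
    by simp
  from LeastI[of "\<lambda>k. 1 \<le> k \<and>
      tensor_range I (tensor_power I A k) = tensor_range I (tensor_power I A (k + 1))", OF this]
  show ?thesis
    unfolding tensor_ind_def by blast
qed

text \<open>Once the range is stable from exponent k to k + 1, it stays stable: each step up
  contributes one more right factor \<open>Y\<close>.\<close>

lemma tensor_power_ind_factor:
  assumes A: "A \<in> tensors2 I"
  shows "\<exists>Y\<in>tensors2 I. tensor_power I A (tensor_ind I A) = tensor_power I A (tensor_ind I A + n) \<star>\<^bsub>I\<^esub> Y"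
proof (induction n)
  case 0
  show ?case using A by (intro bexI[of _ "identity_tensor I"]) auto
next
  case (Suc n)
  let ?k = "tensor_ind I A"
  obtain Y where Y: "Y \<in> tensors2 I" "tensor_power I A ?k = tensor_power I A (?k + 1) \<star>\<^bsub>I\<^esub> Y"
    using tensor_range_subset_factor[of "tensor_power I A ?k" I "tensor_power I A (?k + 1)"]
      tensor_ind_range[OF A] A by auto
  from Suc obtain W where W: "W \<in> tensors2 I"
    "tensor_power I A ?k = tensor_power I A (?k + n) \<star>\<^bsub>I\<^esub> W" by blast
  have "tensor_power I A (?k + n) = tensor_power I A n \<star>\<^bsub>I\<^esub> tensor_power I A ?k"
    using A by (simp add: add.commute flip: tensor_power_add)
  also have "\<dots> = tensor_power I A n \<star>\<^bsub>I\<^esub> tensor_power I A (?k + 1) \<star>\<^bsub>I\<^esub> Y"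
    using arg_cong[OF Y(2), of "\<lambda>Z. tensor_power I A n \<star>\<^bsub>I\<^esub> Z"] by (simp only: einstein_assoc)
  also have "\<dots> = tensor_power I A (?k + Suc n) \<star>\<^bsub>I\<^esub> Y"
    using A by (simp add: add_ac flip: tensor_power_add del: tensor_power.simps)
  finally have shift: "tensor_power I A (?k + n) = tensor_power I A (?k + Suc n) \<star>\<^bsub>I\<^esub> Y" .
  have "tensor_power I A ?k = tensor_power I A (?k + Suc n) \<star>\<^bsub>I\<^esub> (Y \<star>\<^bsub>I\<^esub> W)"
    unfolding einstein_extend2[OF shift[symmetric]] by (rule W(2))
  then show ?case
    using einstein_closed[OF Y(1) W(1)] by (rule bexI)
qed

section \<open>Uniqueness and existence of the Drazin inverse\<close>

text \<open>The assumptions give X = AXX, and substituting this repeatedly exposes any power of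
  \<open>A\<close> as a left factor of \<open>X\<close>.\<close>

lemma power_split_commuting:
  assumes "A \<in> tensors2 I" "X \<in> tensors2 I" "X \<star>\<^bsub>I\<^esub> A \<star>\<^bsub>I\<^esub> X = X" "X \<star>\<^bsub>I\<^esub> A = A \<star>\<^bsub>I\<^esub> X"
  shows "X = tensor_power I A n \<star>\<^bsub>I\<^esub> tensor_power I X (Suc n)"
proof (induction n)
  case 0
  show ?case using assms by simp
next
  case (Suc n)
  have "tensor_power I A (Suc n) \<star>\<^bsub>I\<^esub> tensor_power I X (Suc (Suc n))
      = tensor_power I A n \<star>\<^bsub>I\<^esub> (A \<star>\<^bsub>I\<^esub> (X \<star>\<^bsub>I\<^esub> X)) \<star>\<^bsub>I\<^esub> tensor_power I X n"
    by (simp only: tensor_power.simps(2)[of I A] tensor_power_Suc_left[OF assms(2)] einstein_assoc)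
  also have "A \<star>\<^bsub>I\<^esub> (X \<star>\<^bsub>I\<^esub> X) = X"
    using assms(3,4) by (simp flip: einstein_assoc)
  also have "tensor_power I A n \<star>\<^bsub>I\<^esub> X \<star>\<^bsub>I\<^esub> tensor_power I X n = tensor_power I A n \<star>\<^bsub>I\<^esub> tensor_power I X (Suc n)"
    by (simp only: tensor_power_Suc_left[OF assms(2)] einstein_assoc)
  also have "\<dots> = X"
    by (rule Suc[symmetric])
  finally show ?case by (rule sym)
qed

text \<open>Both tensors equal XAY: \<open>X\<close> ends in A^k, which absorbs AY on the right, and
  \<open>Y\<close> begins with A^k, which absorbs XA on the left.\<close>

lemma is_drazin_inverse_unique:
  assumes A: "A \<in> tensors2 I" and X: "is_drazin_inverse I A X" and Y: "is_drazin_inverse I A Y"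
  shows "X = Y"
proof -
  let ?k = "tensor_ind I A"
  have Xp: "X \<in> tensors2 I" "X \<star>\<^bsub>I\<^esub> A \<star>\<^bsub>I\<^esub> X = X" "X \<star>\<^bsub>I\<^esub> A = A \<star>\<^bsub>I\<^esub> X"
    "X \<star>\<^bsub>I\<^esub> tensor_power I A (Suc ?k) = tensor_power I A ?k"
    using X tensor_power_commute[OF A, of X "Suc ?k"] by (auto simp: is_drazin_inverse_def)
  have Yp: "Y \<in> tensors2 I" "Y \<star>\<^bsub>I\<^esub> A \<star>\<^bsub>I\<^esub> Y = Y" "Y \<star>\<^bsub>I\<^esub> A = A \<star>\<^bsub>I\<^esub> Y"
    "tensor_power I A (Suc ?k) \<star>\<^bsub>I\<^esub> Y = tensor_power I A ?k"
    using Y by (auto simp: is_drazin_inverse_def)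
  have powX: "X = tensor_power I X (Suc ?k) \<star>\<^bsub>I\<^esub> tensor_power I A ?k"
  proof -
    have "tensor_power I X (Suc ?k) \<star>\<^bsub>I\<^esub> A = A \<star>\<^bsub>I\<^esub> tensor_power I X (Suc ?k)"
      by (rule tensor_power_commute[OF Xp(1) A Xp(3)[symmetric], symmetric])
    from tensor_power_commute[OF A tensor_power_closed[OF Xp(1)] this, of ?k]
    show ?thesis
      using power_split_commuting[OF A Xp(1-3), of ?k] by simp
  qed
  have "tensor_power I A ?k \<star>\<^bsub>I\<^esub> (A \<star>\<^bsub>I\<^esub> Y) = tensor_power I A ?k"
    using Yp(4) by (simp add: einstein_assoc)
  then have "tensor_power I X (Suc ?k) \<star>\<^bsub>I\<^esub> tensor_power I A ?k \<star>\<^bsub>I\<^esub> (A \<star>\<^bsub>I\<^esub> Y)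
      = tensor_power I X (Suc ?k) \<star>\<^bsub>I\<^esub> tensor_power I A ?k"
    by (simp only: einstein_assoc)
  then have "X = X \<star>\<^bsub>I\<^esub> (A \<star>\<^bsub>I\<^esub> Y)"
    by (simp only: powX[symmetric])
  moreover have "Y = X \<star>\<^bsub>I\<^esub> (A \<star>\<^bsub>I\<^esub> Y)"
  proof -
    have "Y = tensor_power I A ?k \<star>\<^bsub>I\<^esub> tensor_power I Y (Suc ?k)"
      using power_split_commuting[OF A Yp(1-3)] .
    moreover have "X \<star>\<^bsub>I\<^esub> A \<star>\<^bsub>I\<^esub> tensor_power I A ?k = tensor_power I A ?k"
      using Xp(4) by (simp only: tensor_power_Suc_left[OF A] einstein_assoc)
    from einstein_extend3[OF this, of "tensor_power I Y (Suc ?k)"]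
    have "X \<star>\<^bsub>I\<^esub> (A \<star>\<^bsub>I\<^esub> (tensor_power I A ?k \<star>\<^bsub>I\<^esub> tensor_power I Y (Suc ?k)))
        = tensor_power I A ?k \<star>\<^bsub>I\<^esub> tensor_power I Y (Suc ?k)" .
    ultimately show ?thesis by simp
  qed
  ultimately show ?thesis by simp
qed

lemma is_drazin_inverse_exists:
  assumes A: "A \<in> tensors2 I"
  shows "\<exists>X. is_drazin_inverse I A X"
proof -
  let ?k = "tensor_ind I A"
  obtain m R where R: "R \<in> tensors2 I" "R \<star>\<^bsub>I\<^esub> A = A \<star>\<^bsub>I\<^esub> R"
    and AR: "tensor_power I A m = tensor_power I A (Suc m) \<star>\<^bsub>I\<^esub> R"
    using tensor_power_eq_Suc_commuting[OF A] by blast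
  have AR_pow: "A \<star>\<^bsub>I\<^esub> (R \<star>\<^bsub>I\<^esub> tensor_power I A n) = tensor_power I A (Suc n) \<star>\<^bsub>I\<^esub> R" for n
    using A by (simp only: tensor_power_commute[OF A R] tensor_power_Suc_left einstein_assoc)
  have pow_AR: "tensor_power I A n \<star>\<^bsub>I\<^esub> (A \<star>\<^bsub>I\<^esub> R) = tensor_power I A (Suc n) \<star>\<^bsub>I\<^esub> R" for n
    by (simp add: einstein_assoc)
  \<comment> \<open>The exponent \<open>m\<close> of the relation is unrelated to the index.
    Factoring A^k through A^(m+k) carries the identity A R A^m = A^m over to A^k.\<close>
  obtain Y where Y: "Y \<in> tensors2 I" "tensor_power I A ?k = tensor_power I A (m + ?k) \<star>\<^bsub>I\<^esub> Y"
    using tensor_power_ind_factor[OF A, of m] by (auto simp: add.commute)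
  have "A \<star>\<^bsub>I\<^esub> R \<star>\<^bsub>I\<^esub> tensor_power I A m = tensor_power I A m"
    using AR AR_pow[of m] by (simp only: einstein_assoc)
  then have "A \<star>\<^bsub>I\<^esub> R \<star>\<^bsub>I\<^esub> tensor_power I A (m + ?k) = tensor_power I A (m + ?k)"
    using A by (simp add: tensor_power_add flip: einstein_assoc)
  from einstein_extend2[OF this, of Y]
  have ARk: "A \<star>\<^bsub>I\<^esub> (R \<star>\<^bsub>I\<^esub> tensor_power I A ?k) = tensor_power I A ?k"
    by (simp only: einstein_assoc flip: Y(2))
  have AkR: "tensor_power I A (n + ?k) \<star>\<^bsub>I\<^esub> (A \<star>\<^bsub>I\<^esub> R) = tensor_power I A (n + ?k)" for n
  proof -
    have "tensor_power I A ?k \<star>\<^bsub>I\<^esub> (A \<star>\<^bsub>I\<^esub> R) = tensor_power I A ?k"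
      using ARk unfolding AR_pow pow_AR .
    then show ?thesis
      by (simp only: tensor_power_add[OF A] einstein_assoc)
  qed
  have kpow: "tensor_power I A (n + ?k) \<star>\<^bsub>I\<^esub> tensor_power I R n = tensor_power I A ?k" for n
  proof (induction n)
    case 0
    show ?case using A by simp
  next
    case (Suc n)
    have "tensor_power I A (Suc n + ?k) \<star>\<^bsub>I\<^esub> tensor_power I R (Suc n)
        = tensor_power I A (n + ?k) \<star>\<^bsub>I\<^esub> (A \<star>\<^bsub>I\<^esub> R) \<star>\<^bsub>I\<^esub> tensor_power I R n"
      by (simp only: add_Suc tensor_power.simps(2)[of I A] tensor_power_Suc_left[OF R(1)] einstein_assoc)
    with Suc AkR show ?case by simp
  qed
  define Q where "Q = tensor_power I R (Suc ?k)"
  \<comment> \<open>The witness is A^k R^(k+1), where \<open>R\<close> acts as an inverse of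
    \<open>A\<close> on the range of A^k.\<close>
  define X where "X = tensor_power I A ?k \<star>\<^bsub>I\<^esub> Q"
  have Q: "Q \<in> tensors2 I" "Q \<star>\<^bsub>I\<^esub> A = A \<star>\<^bsub>I\<^esub> Q"
    unfolding Q_def
    by (rule tensor_power_closed[OF R(1)], rule tensor_power_commute[OF R(1) A R(2)[symmetric], symmetric])
  have X: "X \<in> tensors2 I"
    using A Q by (simp add: X_def)
  have comm: "X \<star>\<^bsub>I\<^esub> A = A \<star>\<^bsub>I\<^esub> X"
    using einstein_extend2[OF tensor_power_commute[OF A A refl, of ?k]]
    by (simp add: X_def Q(2) einstein_assoc)
  have AX: "tensor_power I A (?k + 1) \<star>\<^bsub>I\<^esub> X = tensor_power I A ?k"
  proof -
    have "tensor_power I A (?k + 1) \<star>\<^bsub>I\<^esub> X = tensor_power I A (Suc ?k + ?k) \<star>\<^bsub>I\<^esub> Q"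
      using tensor_power_add[OF A, of "Suc ?k" ?k] by (simp add: X_def einstein_assoc)
    then show ?thesis using kpow[of "Suc ?k"] by (simp add: Q_def)
  qed
  have "X \<star>\<^bsub>I\<^esub> tensor_power I A (Suc ?k) = tensor_power I A ?k"
    using AX tensor_power_commute[OF A X comm, of "Suc ?k"] by simp
  \<comment> \<open>XA fixes A^k and therefore \<open>X\<close>, which has A^k as its left
    factor.\<close>
  then have "X \<star>\<^bsub>I\<^esub> A \<star>\<^bsub>I\<^esub> tensor_power I A ?k = tensor_power I A ?k"
    by (simp only: tensor_power_Suc_left[OF A] einstein_assoc)
  from einstein_extend3[OF this, of Q] have "X \<star>\<^bsub>I\<^esub> A \<star>\<^bsub>I\<^esub> X = X"
    by (simp add: X_def einstein_assoc)
  with X comm AX have "is_drazin_inverse I A X"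
    by (simp add: is_drazin_inverse_def)
  then show ?thesis by (intro exI)
qed

lemma is_drazin_inverse_drazin_inverse:
  "A \<in> tensors2 I \<Longrightarrow> is_drazin_inverse I A (drazin_inverse I A)"
  unfolding drazin_inverse_def
  using is_drazin_inverse_exists is_drazin_inverse_unique by (metis theI)

section \<open>Core-EP inverse\<close>

text \<open>AX and AY are Hermitian and fix A^k, through which both factor on the left, so they are
  the same projection. As XA also fixes A^k, X = XAX = XAY = Y.\<close>

lemma is_core_ep_inverse_unique:
  assumes A: "A \<in> tensors2 I" and X: "is_core_ep_inverse I A X" and Y: "is_core_ep_inverse I A Y"
  shows "X = Y"
proof -
  let ?k = "tensor_ind I A"
  let ?K = "tensor_power I A ?k"
  have facts: "Z \<star>\<^bsub>I\<^esub> (A \<star>\<^bsub>I\<^esub> ?K) = ?K" "conj_transpose (A \<star>\<^bsub>I\<^esub> Z) = A \<star>\<^bsub>I\<^esub> Z"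
    "A \<star>\<^bsub>I\<^esub> Z \<star>\<^bsub>I\<^esub> ?K = ?K" "\<exists>U. Z = ?K \<star>\<^bsub>I\<^esub> U"
    if Z: "is_core_ep_inverse I A Z" for Z
  proof -
    have Zcl: "Z \<in> tensors2 I" and AZZ: "A \<star>\<^bsub>I\<^esub> (Z \<star>\<^bsub>I\<^esub> Z) = Z"
      using Z by (auto simp: is_core_ep_inverse_def numeral_2_eq_2)
    show 1: "Z \<star>\<^bsub>I\<^esub> (A \<star>\<^bsub>I\<^esub> ?K) = ?K"
      using Z tensor_power_Suc_left[OF A, of ?k] by (simp add: is_core_ep_inverse_def)
    show "conj_transpose (A \<star>\<^bsub>I\<^esub> Z) = A \<star>\<^bsub>I\<^esub> Z"
      using Z by (simp add: is_core_ep_inverse_def)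
    have "A \<star>\<^bsub>I\<^esub> Z \<star>\<^bsub>I\<^esub> ?K = A \<star>\<^bsub>I\<^esub> Z \<star>\<^bsub>I\<^esub> (Z \<star>\<^bsub>I\<^esub> (A \<star>\<^bsub>I\<^esub> ?K))"
      by (simp only: 1)
    also have "\<dots> = A \<star>\<^bsub>I\<^esub> (Z \<star>\<^bsub>I\<^esub> Z) \<star>\<^bsub>I\<^esub> (A \<star>\<^bsub>I\<^esub> ?K)"
      by (simp only: einstein_assoc)
    also have "\<dots> = ?K"
      by (simp only: AZZ 1)
    finally show "A \<star>\<^bsub>I\<^esub> Z \<star>\<^bsub>I\<^esub> ?K = ?K" .
    \<comment> \<open>Iterating Z = AZZ shows that \<open>Z\<close> factors through A^k on the
      left.\<close>
    have "tensor_power I A n \<star>\<^bsub>I\<^esub> tensor_power I Z (Suc n) = Z" for n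
    proof (induction n)
      case 0
      show ?case using Zcl by simp
    next
      case (Suc n)
      have "tensor_power I A (Suc n) \<star>\<^bsub>I\<^esub> tensor_power I Z (Suc (Suc n))
          = tensor_power I A n \<star>\<^bsub>I\<^esub> (A \<star>\<^bsub>I\<^esub> (Z \<star>\<^bsub>I\<^esub> Z) \<star>\<^bsub>I\<^esub> tensor_power I Z n)"
        by (simp only: tensor_power.simps(2)[of I A] tensor_power_Suc_left[OF Zcl] einstein_assoc)
      with Suc show ?case
        by (simp only: AZZ tensor_power_Suc_left[OF Zcl])
    qed
    then show "\<exists>U. Z = ?K \<star>\<^bsub>I\<^esub> U" by metis
  qed
  obtain U V where UV: "X = ?K \<star>\<^bsub>I\<^esub> U" "Y = ?K \<star>\<^bsub>I\<^esub> V"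
    using facts(4)[OF X] facts(4)[OF Y] by blast
  have K: "A \<star>\<^bsub>I\<^esub> ?K = ?K \<star>\<^bsub>I\<^esub> A"
    using tensor_power_commute[OF A A] by simp
  have XY: "(A \<star>\<^bsub>I\<^esub> X) \<star>\<^bsub>I\<^esub> (A \<star>\<^bsub>I\<^esub> Y) = A \<star>\<^bsub>I\<^esub> Y"
    using einstein_extend3[OF facts(3)[OF X]] einstein_extend2[OF K] by (simp add: UV(2) einstein_assoc)
  have YX: "(A \<star>\<^bsub>I\<^esub> Y) \<star>\<^bsub>I\<^esub> (A \<star>\<^bsub>I\<^esub> X) = A \<star>\<^bsub>I\<^esub> X"
    using einstein_extend3[OF facts(3)[OF Y]] einstein_extend2[OF K] by (simp add: UV(1) einstein_assoc)
  \<comment> \<open>Conjugate transposition reverses the product in \<open>YX\<close>, so (AX)(AY)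
    equals AX, whereas \<open>XY\<close> says that it equals AY.\<close>
  have eq: "A \<star>\<^bsub>I\<^esub> X = A \<star>\<^bsub>I\<^esub> Y"
    using arg_cong[OF YX, of conj_transpose] XY facts(2)[OF X] facts(2)[OF Y]
    by (simp add: conj_transpose_einstein[of "A \<star>\<^bsub>I\<^esub> Y"])
  have XAK: "X \<star>\<^bsub>I\<^esub> A \<star>\<^bsub>I\<^esub> ?K = ?K"
    using facts(1)[OF X] by (simp add: einstein_assoc)
  have "X = X \<star>\<^bsub>I\<^esub> (A \<star>\<^bsub>I\<^esub> X)"
    using einstein_extend3[OF XAK, of U] UV(1) by simp
  also have "\<dots> = Y"
    unfolding eq using einstein_extend3[OF XAK, of V] UV(2) by simp
  finally show ?thesis .
qed

section \<open>The representation of the core-EP inverse\<close>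

text \<open>Put P = A^l M. As AD fixes A^l, A(DP) = P, which is Hermitian. P fixes A^k, so DP
  A^(k+1) = D A^(k+1) = A^k; P fixes \<open>D\<close>, so A(DP)(DP) = P D P = DP.\<close>

lemma is_core_ep_inverse_drazin_projection:
  assumes A: "A \<in> tensors2 I" and l: "tensor_ind I A \<le> l"
    and D: "is_drazin_inverse I A D" and M: "is_mp_inverse I (tensor_power I A l) M"
  shows "is_core_ep_inverse I A (D \<star>\<^bsub>I\<^esub> tensor_power I A l \<star>\<^bsub>I\<^esub> M)" (is "is_core_ep_inverse I A ?X")
    and "A \<star>\<^bsub>I\<^esub> (D \<star>\<^bsub>I\<^esub> tensor_power I A l \<star>\<^bsub>I\<^esub> M) = tensor_power I A l \<star>\<^bsub>I\<^esub> M"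
proof -
  let ?k = "tensor_ind I A"
  let ?L = "tensor_power I A l"
  obtain n where n: "l = ?k + n"
    using l le_Suc_ex by blast
  obtain W where W: "tensor_power I A ?k = ?L \<star>\<^bsub>I\<^esub> W"
    using tensor_power_ind_factor[OF A, of n] n by blast
  have Dp: "D \<in> tensors2 I" "D \<star>\<^bsub>I\<^esub> A \<star>\<^bsub>I\<^esub> D = D" "D \<star>\<^bsub>I\<^esub> A = A \<star>\<^bsub>I\<^esub> D"
    "D \<star>\<^bsub>I\<^esub> tensor_power I A (?k + 1) = tensor_power I A ?k"
    using D tensor_power_commute[OF A, of D "?k + 1"] by (auto simp: is_drazin_inverse_def)
  have M1: "M \<in> tensors2 I" "?L \<star>\<^bsub>I\<^esub> M \<star>\<^bsub>I\<^esub> ?L = ?L" "conj_transpose (?L \<star>\<^bsub>I\<^esub> M) = ?L \<star>\<^bsub>I\<^esub> M"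
    using M by (auto simp: is_mp_inverse_def)
  have "D \<star>\<^bsub>I\<^esub> A \<star>\<^bsub>I\<^esub> tensor_power I A ?k = tensor_power I A ?k"
    using Dp(4) by (simp only: tensor_power_Suc_left[OF A] einstein_assoc Suc_eq_plus1[symmetric])
  \<comment> \<open>Here k \<le> l enters: DA fixes A^k and hence A^l = A^k A^n.\<close>
  then have ADL: "A \<star>\<^bsub>I\<^esub> (D \<star>\<^bsub>I\<^esub> ?L) = ?L"
    using A by (simp add: n tensor_power_add flip: einstein_assoc Dp(3))
  then show AX: "A \<star>\<^bsub>I\<^esub> ?X = ?L \<star>\<^bsub>I\<^esub> M"
    using einstein_extend3[of A I D ?L ?L M] by (simp add: einstein_assoc)
  have PK: "?L \<star>\<^bsub>I\<^esub> M \<star>\<^bsub>I\<^esub> tensor_power I A ?k = tensor_power I A ?k"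
    using einstein_extend3[OF M1(2), of W] by (simp add: W einstein_assoc)
  have PD: "?L \<star>\<^bsub>I\<^esub> M \<star>\<^bsub>I\<^esub> D = D"
  proof -
    \<comment> \<open>\<open>D\<close> has A^l as a left factor, and P fixes A^l.\<close>
    have "D = ?L \<star>\<^bsub>I\<^esub> tensor_power I D (Suc l)"
      using power_split_commuting[OF A Dp(1-3)] .
    then show ?thesis
      using einstein_extend3[OF M1(2), of "tensor_power I D (Suc l)"] by (simp only: einstein_assoc)
  qed
  have "?X \<star>\<^bsub>I\<^esub> tensor_power I A (?k + 1) = D \<star>\<^bsub>I\<^esub> (?L \<star>\<^bsub>I\<^esub> M \<star>\<^bsub>I\<^esub> tensor_power I A ?k) \<star>\<^bsub>I\<^esub> A"
    by (simp add: einstein_assoc)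
  also have "\<dots> = tensor_power I A ?k"
    unfolding PK using Dp(4) by (simp add: einstein_assoc)
  finally have 1: "?X \<star>\<^bsub>I\<^esub> tensor_power I A (?k + 1) = tensor_power I A ?k" .
  have Xcl: "?X \<in> tensors2 I"
    using A Dp M1 by simp
  have "A \<star>\<^bsub>I\<^esub> tensor_power I ?X 2 = A \<star>\<^bsub>I\<^esub> ?X \<star>\<^bsub>I\<^esub> ?X"
    using Xcl by (simp add: numeral_2_eq_2 einstein_assoc)
  also have "\<dots> = ?X"
    unfolding AX using einstein_extend3[OF PD] by (simp add: einstein_assoc)
  finally show "is_core_ep_inverse I A ?X"
    using 1 Xcl AX M1(3) by (simp add: is_core_ep_inverse_def)
qed

theorem theorem4p2:
  fixes I :: "nat list" and A :: tensor2 and k l :: nat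
  assumes "I \<noteq> []"
    and "\<forall>n\<in>set I. 1 \<le> n"
    and "A \<in> tensors2 I"
    and "tensor_ind I A = k"
    and "k \<le> l"
  shows "core_ep_inverse I A =
           drazin_inverse I A \<star>\<^bsub>I\<^esub> tensor_power I A l \<star>\<^bsub>I\<^esub> mp_inverse I (tensor_power I A l)
         \<and> A \<star>\<^bsub>I\<^esub> core_ep_inverse I A =
           tensor_power I A l \<star>\<^bsub>I\<^esub> mp_inverse I (tensor_power I A l)"
proof -
  let ?X = "drazin_inverse I A \<star>\<^bsub>I\<^esub> tensor_power I A l \<star>\<^bsub>I\<^esub> mp_inverse I (tensor_power I A l)"
  have X: "is_core_ep_inverse I A ?X"
    "A \<star>\<^bsub>I\<^esub> ?X = tensor_power I A l \<star>\<^bsub>I\<^esub> mp_inverse I (tensor_power I A l)"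
    using is_core_ep_inverse_drazin_projection is_drazin_inverse_drazin_inverse
      is_mp_inverse_mp_inverse tensor_power_closed assms(3-5) by blast+
  \<comment> \<open>The core-EP inverse is a definite description, so exhibiting one solution
    together with uniqueness identifies it.\<close>
  have "core_ep_inverse I A = ?X"
    unfolding core_ep_inverse_def
    using X(1) is_core_ep_inverse_unique[OF assms(3)] by (intro the_equality) blast+
  with X(2) show ?thesis by simp
qed

end
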